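(* Let $\mathbb{K}$ be a field of characteristic zero and let $\mathfrak{M}$ be a finite-dimensional Lie algebra over $\mathbb{K}$ which is a vector space direct sum $\mathfrak{M}=L_1\dotplus L_2$ of a subspace $L_1$ and an abelian subalgebra $L_2$. Let $\{X_1,\dots,X_t\}$ be a basis of $L_2$, extended by a basis $\{X_{t+1},\dots,X_s\}$ of $L_1$ to a basis $\{X_1,\dots,X_s\}$ of $\mathfrak{M}$, and let $x_1,\dots,x_s$ be the corresponding coordinates on $\mathfrak{M}^*$. Let $B=\left([x_i,x_j]\right)_{1\le i\le t,\ t+1\le j\le s}$. Suppose that $\dim L_2\geq\dim L_1$ and that the matrix $B$ is of maximal rank. (a) Every invariant $F$ of $\mathfrak{M}$ is of the form $F=F(x_1,\dots,x_t)$; that is, $F$ depends only on the elements of the abelian subalgebra $L_2$. (b) All invariants of $\mathfrak{M}$ are completely determined by the $[L_1,L_2]$-type commutation relations alone; that is, a function $F$ is an invariant of $\mathfrak{M}$ if and only if it is of the form $F=F(x_1,\dots,x_t)$ and satisfies $$\sum_{i=1}^t [x_j,x_i]\,\frac{\partial F}{\partial x_i}=0\qquad\text{for } j=t+1,\dots,s.$$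
   Context: Notation: with structure constants $[X_i,X_j]=\sum_k c_{ij}^k X_k$, the coordinates are $x_k(f)=f(X_k)$ for $f\in\mathfrak{M}^*$, and $[x_i,x_j]$ denotes the linear function $\sum_k c_{ij}^k x_k$ on $\mathfrak{M}^*$. The rank of $B$ is its rank over the field $\mathbb{K}(x_1,\dots,x_s)$ (generic rank); "maximal rank" means rank equal to $\min(t,s-t)$. Invariants: an invariant of $\mathfrak{M}$ (an invariant of the coadjoint representation) is a function $F$ of $x_1,\dots,x_s$ satisfying $\sum_{j=1}^s [x_i,x_j]\,\partial F/\partial x_j=0$ for $i=1,\dots,s$. Here functions are analytic functions on nonempty connected open subsets of $\mathfrak{M}^*$ when $\mathbb{K}=\mathbb{R}$ or $\mathbb{C}$; for general $\mathbb{K}$ they are understood formally, as formal power series over $\mathbb{K}$ around a point of $\mathfrak{M}^*$. "$F=F(x_1,\dots,x_t)$" means that $\partial F/\partial x_j$ vanishes identically for $j=t+1,\dots,s$. *)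

theory Defs
  imports
    "HOL-Analysis.Analysis"
    "HOL-Library.Poly_Mapping"
    "HOL-Computational_Algebra.Fraction_Field"
    "HOL-Computational_Algebra.Normalized_Fraction"
    "Jordan_Normal_Form.DL_Rank"
begin

section \<open>Lie algebras with an abelian subalgebra\<close>

locale lie_algebra = vector_space smul
  for smul :: "'k::field \<Rightarrow> 'v::ab_group_add \<Rightarrow> 'v" +
  fixes bracket :: "'v \<Rightarrow> 'v \<Rightarrow> 'v"
  assumes linear_right: "Vector_Spaces.linear smul smul (\<lambda>y. bracket x y)"
    and linear_left: "Vector_Spaces.linear smul smul (\<lambda>x. bracket x y)"
    and bracket_self: "bracket x x = 0"
    and jacobi: "bracket x (bracket y z) + bracket y (bracket z x) + bracket z (bracket x y) = 0"
begin

definition lie_subalgebra :: "'v set \<Rightarrow> bool" where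
  "lie_subalgebra L \<longleftrightarrow> subspace L \<and> (\<forall>x\<in>L. \<forall>y\<in>L. bracket x y \<in> L)"

definition abelian_subalgebra :: "'v set \<Rightarrow> bool" where
  "abelian_subalgebra L \<longleftrightarrow> lie_subalgebra L \<and> (\<forall>x\<in>L. \<forall>y\<in>L. bracket x y = 0)"

end

text \<open>
  Basis vectors are indexed from \<open>0\<close>: the vectors \<open>X 0, \<dots>, X (t - 1)\<close> form a basis of \<open>L2\<close>,
  and \<open>X t, \<dots>, X (s - 1)\<close> form a basis of \<open>L1\<close>. The Lie algebra is the whole type \<open>'v\<close>; its
  finite dimension \<open>s\<close> is a consequence of the assumptions.
\<close>

locale abelian_decomposition = lie_algebra smul bracket
  for smul :: "'k::field \<Rightarrow> 'v::ab_group_add \<Rightarrow> 'v"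
    and bracket :: "'v \<Rightarrow> 'v \<Rightarrow> 'v" +
  fixes L1 L2 :: "'v set" and t s :: nat and X :: "nat \<Rightarrow> 'v"
  assumes subspace_L1: "subspace L1"
    and abelian_L2: "abelian_subalgebra L2"
    and sum_L1_L2: "{a + b | a b. a \<in> L1 \<and> b \<in> L2} = UNIV"
    and direct_L1_L2: "L1 \<inter> L2 = {0}"
    and t_le_s: "t \<le> s"
    and inj_X: "inj_on X {..<s}"
    and independent_X: "independent (X ` {..<s})"
    and span_L2: "span (X ` {..<t}) = L2"
    and span_L1: "span (X ` {t..<s}) = L1"

definition structure_constant ::
  "('k::field \<Rightarrow> 'v::ab_group_add \<Rightarrow> 'v) \<Rightarrow> ('v \<Rightarrow> 'v \<Rightarrow> 'v) \<Rightarrow> nat \<Rightarrow> (nat \<Rightarrow> 'v)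
    \<Rightarrow> nat \<Rightarrow> nat \<Rightarrow> nat \<Rightarrow> 'k" where
  "structure_constant smul bracket s X i j k =
     Modules.module.representation smul (X ` {..<s}) (bracket (X i) (X j)) (X k)"

section \<open>The matrix of brackets and its generic rank\<close>

text \<open>
  Polynomials over \<open>'k\<close> are finitely supported functions on exponent vectors \<open>nat \<Rightarrow>\<^sub>0 nat\<close>.
  From here on \<open>c i j k\<close> stands for the structure constants.
\<close>

definition bracket_poly ::
  "(nat \<Rightarrow> nat \<Rightarrow> nat \<Rightarrow> 'k::field) \<Rightarrow> nat \<Rightarrow> nat \<Rightarrow> nat \<Rightarrow> ((nat \<Rightarrow>\<^sub>0 nat) \<Rightarrow>\<^sub>0 'k)" where
  "bracket_poly c s i j =
     (\<Sum>k<s. Poly_Mapping.single (Poly_Mapping.single k 1) (c i j k))"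

definition bracket_matrix ::
  "(nat \<Rightarrow> nat \<Rightarrow> nat \<Rightarrow> 'k::field) \<Rightarrow> nat \<Rightarrow> nat \<Rightarrow> ((nat \<Rightarrow>\<^sub>0 nat) \<Rightarrow>\<^sub>0 'k) fract mat" where
  "bracket_matrix c t s = mat t (s - t) (\<lambda>(i, j). to_fract (bracket_poly c s i (t + j)))"

text \<open>
  The entries lie in the rational function field in the variables \<open>x\<^sub>k\<close> with \<open>k < s\<close>. The rank is
  taken over the rational functions in all variables \<open>x\<^sub>k\<close>, \<open>k :: nat\<close>; an extension of the base
  field does not change the rank of a matrix.
\<close>

definition has_maximal_rank :: "(nat \<Rightarrow> nat \<Rightarrow> nat \<Rightarrow> 'k::field) \<Rightarrow> nat \<Rightarrow> nat \<Rightarrow> bool" where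
  "has_maximal_rank c t s \<longleftrightarrow> vec_space.rank t (bracket_matrix c t s) = min t (s - t)"

section \<open>The dual space\<close>

definition dual_space :: "('k::field \<Rightarrow> 'v::ab_group_add \<Rightarrow> 'v) \<Rightarrow> ('v \<Rightarrow> 'k) set" where
  "dual_space smul = {f. Vector_Spaces.linear smul (*) f}"

section \<open>Formal invariants\<close>

text \<open>
  A formal power series around a point \<open>p\<close> of the dual space is its coefficient function on
  exponent vectors, with respect to the variables \<open>y\<^sub>k = x\<^sub>k - p (X k)\<close>, \<open>k < s\<close>.
\<close>

type_synonym 'k power_series = "(nat \<Rightarrow>\<^sub>0 nat) \<Rightarrow> 'k"

definition power_series_in :: "nat \<Rightarrow> 'k::field power_series \<Rightarrow> bool" where
  "power_series_in s F \<longleftrightarrow> (\<forall>\<alpha>. F \<alpha> \<noteq> 0 \<longrightarrow> Poly_Mapping.keys \<alpha> \<subseteq> {..<s})"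

definition ps_mult :: "'k::field power_series \<Rightarrow> 'k power_series \<Rightarrow> 'k power_series" where
  "ps_mult F G = (\<lambda>\<gamma>. \<Sum>(\<alpha>, \<beta>) \<in> {(\<alpha>, \<beta>). \<alpha> + \<beta> = \<gamma>}. F \<alpha> * G \<beta>)"

definition ps_partial :: "nat \<Rightarrow> 'k::field power_series \<Rightarrow> 'k power_series" where
  "ps_partial j F =
     (\<lambda>\<alpha>. of_nat (Poly_Mapping.lookup \<alpha> j + 1) * F (\<alpha> + Poly_Mapping.single j 1))"

text \<open>The coordinate \<open>x\<^sub>k = a + y\<^sub>k\<close>, where \<open>a\<close> is its value at the centre.\<close>

definition ps_coord :: "'k::field \<Rightarrow> nat \<Rightarrow> 'k power_series" where
  "ps_coord a k =
     (\<lambda>\<alpha>. if \<alpha> = 0 then a else if \<alpha> = Poly_Mapping.single k 1 then 1 else 0)"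

definition ps_bracket ::
  "(nat \<Rightarrow> nat \<Rightarrow> nat \<Rightarrow> 'k::field) \<Rightarrow> nat \<Rightarrow> (nat \<Rightarrow> 'k) \<Rightarrow> nat \<Rightarrow> nat \<Rightarrow> 'k power_series" where
  "ps_bracket c s a i j = (\<lambda>\<alpha>. \<Sum>k<s. c i j k * ps_coord (a k) k \<alpha>)"

definition formal_invariant ::
  "(nat \<Rightarrow> nat \<Rightarrow> nat \<Rightarrow> 'k::field) \<Rightarrow> nat \<Rightarrow> (nat \<Rightarrow> 'k) \<Rightarrow> 'k power_series \<Rightarrow> bool" where
  "formal_invariant c s a F \<longleftrightarrow>
     (\<forall>i<s. \<forall>\<alpha>. (\<Sum>j<s. ps_mult (ps_bracket c s a i j) (ps_partial j F) \<alpha>) = 0)"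

definition formal_depends_only :: "nat \<Rightarrow> nat \<Rightarrow> 'k::field power_series \<Rightarrow> bool" where
  "formal_depends_only t s F \<longleftrightarrow> (\<forall>j\<in>{t..<s}. \<forall>\<alpha>. ps_partial j F \<alpha> = 0)"

definition formal_reduced_system ::
  "(nat \<Rightarrow> nat \<Rightarrow> nat \<Rightarrow> 'k::field) \<Rightarrow> nat \<Rightarrow> nat \<Rightarrow> (nat \<Rightarrow> 'k) \<Rightarrow> 'k power_series \<Rightarrow> bool" where
  "formal_reduced_system c t s a F \<longleftrightarrow>
     (\<forall>j\<in>{t..<s}. \<forall>\<alpha>. (\<Sum>i<t. ps_mult (ps_bracket c s a j i) (ps_partial i F) \<alpha>) = 0)"

section \<open>Analytic invariants\<close>

text \<open>
  The topology on the dual space is that of pointwise convergence, inherited from the product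
  topology on \<open>'v \<Rightarrow> 'k\<close>; for finite-dimensional \<open>'v\<close> it is the usual one.
\<close>

definition dual_domain ::
  "('k::real_normed_field \<Rightarrow> 'v::ab_group_add \<Rightarrow> 'v) \<Rightarrow> ('v \<Rightarrow> 'k) set \<Rightarrow> bool" where
  "dual_domain smul U \<longleftrightarrow>
     openin (top_of_set (dual_space smul)) U \<and> connected U \<and> U \<noteq> {}"

definition analytic_in_coords ::
  "nat \<Rightarrow> (nat \<Rightarrow> 'v) \<Rightarrow> ('v \<Rightarrow> 'k::real_normed_field) set \<Rightarrow> (('v \<Rightarrow> 'k) \<Rightarrow> 'k) \<Rightarrow> bool" where
  "analytic_in_coords s X U F \<longleftrightarrow>
     (\<forall>p\<in>U. \<exists>r>0. \<exists>a :: (nat \<Rightarrow>\<^sub>0 nat) \<Rightarrow> 'k.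
        \<forall>f\<in>U. (\<forall>k<s. norm (f (X k) - p (X k)) < r) \<longrightarrow>
          ((\<lambda>\<alpha>. a \<alpha> * (\<Prod>k<s. (f (X k) - p (X k)) ^ Poly_Mapping.lookup \<alpha> k)) has_sum F f)
            {\<alpha>. Poly_Mapping.keys \<alpha> \<subseteq> {..<s}})"

definition dual_basis ::
  "('k::field \<Rightarrow> 'v::ab_group_add \<Rightarrow> 'v) \<Rightarrow> nat \<Rightarrow> (nat \<Rightarrow> 'v) \<Rightarrow> nat \<Rightarrow> 'v \<Rightarrow> 'k" where
  "dual_basis smul s X j = (\<lambda>v. Modules.module.representation smul (X ` {..<s}) v (X j))"

definition coord_partial ::
  "('k::real_normed_field \<Rightarrow> 'v::ab_group_add \<Rightarrow> 'v) \<Rightarrow> nat \<Rightarrow> (nat \<Rightarrow> 'v) \<Rightarrow> nat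
    \<Rightarrow> (('v \<Rightarrow> 'k) \<Rightarrow> 'k) \<Rightarrow> ('v \<Rightarrow> 'k) \<Rightarrow> 'k" where
  "coord_partial smul s X j F f =
     deriv (\<lambda>h. F (\<lambda>v. f v + h * dual_basis smul s X j v)) 0"

definition bracket_function ::
  "('k::field \<Rightarrow> 'v::ab_group_add \<Rightarrow> 'v) \<Rightarrow> ('v \<Rightarrow> 'v \<Rightarrow> 'v) \<Rightarrow> nat \<Rightarrow> (nat \<Rightarrow> 'v)
    \<Rightarrow> nat \<Rightarrow> nat \<Rightarrow> ('v \<Rightarrow> 'k) \<Rightarrow> 'k" where
  "bracket_function smul bracket s X i j f =
     (\<Sum>k<s. structure_constant smul bracket s X i j k * f (X k))"

definition analytic_invariant ::
  "('k::real_normed_field \<Rightarrow> 'v::ab_group_add \<Rightarrow> 'v) \<Rightarrow> ('v \<Rightarrow> 'v \<Rightarrow> 'v) \<Rightarrow> nat \<Rightarrow> (nat \<Rightarrow> 'v)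
    \<Rightarrow> ('v \<Rightarrow> 'k) set \<Rightarrow> (('v \<Rightarrow> 'k) \<Rightarrow> 'k) \<Rightarrow> bool" where
  "analytic_invariant smul bracket s X U F \<longleftrightarrow>
     (\<forall>i<s. \<forall>f\<in>U.
        (\<Sum>j<s. bracket_function smul bracket s X i j f * coord_partial smul s X j F f) = 0)"

definition analytic_depends_only ::
  "('k::real_normed_field \<Rightarrow> 'v::ab_group_add \<Rightarrow> 'v) \<Rightarrow> nat \<Rightarrow> nat \<Rightarrow> (nat \<Rightarrow> 'v)
    \<Rightarrow> ('v \<Rightarrow> 'k) set \<Rightarrow> (('v \<Rightarrow> 'k) \<Rightarrow> 'k) \<Rightarrow> bool" where
  "analytic_depends_only smul t s X U F \<longleftrightarrow>
     (\<forall>j\<in>{t..<s}. \<forall>f\<in>U. coord_partial smul s X j F f = 0)"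

definition analytic_reduced_system ::
  "('k::real_normed_field \<Rightarrow> 'v::ab_group_add \<Rightarrow> 'v) \<Rightarrow> ('v \<Rightarrow> 'v \<Rightarrow> 'v) \<Rightarrow> nat \<Rightarrow> nat
    \<Rightarrow> (nat \<Rightarrow> 'v) \<Rightarrow> ('v \<Rightarrow> 'k) set \<Rightarrow> (('v \<Rightarrow> 'k) \<Rightarrow> 'k) \<Rightarrow> bool" where
  "analytic_reduced_system smul bracket t s X U F \<longleftrightarrow>
     (\<forall>j\<in>{t..<s}. \<forall>f\<in>U.
        (\<Sum>i<t. bracket_function smul bracket s X j i f * coord_partial smul s X i F f) = 0)"

end

theory Submission
  imports Defs "HOL-Library.Function_Algebras"
begin

text \<open>
  Write \<open>m = s - t\<close>. Since \<open>L2\<close> is abelian, the first \<open>t\<close> equations of an invariant \<open>F\<close> only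
  involve the partial derivatives \<open>G\<^sub>j = \<partial>F / \<partial>x\<^sub>j\<close> with \<open>t \<le> j < s\<close>; they say that the vector \<open>G\<close> lies in the
  kernel of the \<open>t \<times> m\<close> matrix \<open>B\<close>. As \<open>m \<le> t\<close>, maximal rank means that the columns of \<open>B\<close> are
  independent over the rational functions, so \<open>B\<close> has a left inverse there. Clearing denominators
  gives polynomials \<open>D\<^sub>l\<^sub>i\<close> and a polynomial \<open>q \<noteq> 0\<close> with \<open>D B = q I\<close>
  (\<open>bracket_matrix_scaled_left_inverse\<close>), and hence \<open>q G\<^sub>j = 0\<close>: the derivatives vanish wherever \<open>q\<close> does not.
  It remains to see that they vanish everywhere.

  In both settings this is done by restricting to lines through the given point \<open>p\<close>, which
  replaces functions of many variables by functions of one. Since \<open>q\<close> has a nonroot \<open>y\<close>, it is a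
  nonzero polynomial on the line through \<open>p\<close> and \<open>y\<close> and has only finitely many roots on it.

  Formally, restriction to a line \<open>p + h w\<close> is a ring homomorphism from power series around \<open>p\<close> to
  power series in \<open>h\<close>. These form an integral domain, so \<open>G\<^sub>j\<close> vanishes on every line on which \<open>q\<close>
  does not vanish identically. Such directions \<open>w\<close> are dense enough to force each homogeneous part of \<open>G\<^sub>j\<close>
  to be zero (\<open>formal_invariant_depends_only\<close>).

  Analytically, take \<open>p + h w\<close> on the line to \<open>y\<close> with \<open>h \<noteq> 0\<close> small. On the segment through this
  point in the direction of \<open>x\<^sub>j\<close>, the polynomial \<open>q\<close> has finitely many roots, so the derivative of \<open>F\<close> along the
  segment is zero up to finitely many points and \<open>F\<close> is constant there. Letting \<open>h\<close> tend to \<open>0\<close>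
  shows that \<open>F\<close> is constant on the segment through \<open>p\<close> itself
  (\<open>analytic_invariant_depends_only\<close>). This only uses that \<open>F\<close> is differentiable along lines, so
  the power series of the partial derivatives never have to be computed.

  Part (b) follows: once the derivatives with \<open>j \<ge> t\<close> vanish, the first \<open>t\<close> equations are trivial
  and the remaining ones are the reduced system.
\<close>

section \<open>Evaluation of polynomials in several variables\<close>

definition monomial_value :: "(nat \<Rightarrow> 'r::comm_semiring_1) \<Rightarrow> (nat \<Rightarrow>\<^sub>0 nat) \<Rightarrow> 'r" where
  "monomial_value z \<alpha> = (\<Prod>k\<in>Poly_Mapping.keys \<alpha>. z k ^ Poly_Mapping.lookup \<alpha> k)"

definition mpoly_eval ::
  "('k::comm_semiring_1 \<Rightarrow> 'r::comm_semiring_1) \<Rightarrow> (nat \<Rightarrow> 'r) \<Rightarrow> ((nat \<Rightarrow>\<^sub>0 nat) \<Rightarrow>\<^sub>0 'k) \<Rightarrow> 'r" where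
  "mpoly_eval \<phi> z q =
     (\<Sum>\<alpha>\<in>Poly_Mapping.keys q. \<phi> (Poly_Mapping.lookup q \<alpha>) * monomial_value z \<alpha>)"

lemma monomial_value_eq_prod:
  assumes "finite A" "Poly_Mapping.keys \<alpha> \<subseteq> A"
  shows "monomial_value z \<alpha> = (\<Prod>k\<in>A. z k ^ Poly_Mapping.lookup \<alpha> k)"
  unfolding monomial_value_def
  using assms by (intro prod.mono_neutral_left) (auto simp: in_keys_iff)

lemma monomial_value_0 [simp]: "monomial_value z 0 = 1"
  by (simp add: monomial_value_def)

lemma monomial_value_single [simp]: "monomial_value z (Poly_Mapping.single k n) = z k ^ n"
  by (cases "n = 0") (simp_all add: monomial_value_def)

lemma monomial_value_add: "monomial_value z (\<alpha> + \<beta>) = monomial_value z \<alpha> * monomial_value z \<beta>"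
proof -
  let ?A = "Poly_Mapping.keys \<alpha> \<union> Poly_Mapping.keys \<beta>"
  have *: "finite ?A" "Poly_Mapping.keys (\<alpha> + \<beta>) \<subseteq> ?A"
    using Poly_Mapping.keys_add[of \<alpha> \<beta>] by auto
  show ?thesis
    unfolding monomial_value_eq_prod[OF *]
      monomial_value_eq_prod[OF *(1) Un_upper1] monomial_value_eq_prod[OF *(1) Un_upper2]
    by (simp add: lookup_add power_add prod.distrib)
qed

lemma poly_monomial_value:
  "poly (monomial_value z \<alpha>) h = monomial_value (\<lambda>k. poly (z k) h) \<alpha>"
  by (simp add: monomial_value_def poly_prod poly_power)

text \<open>Evaluation at a point is a ring homomorphism; this is what lets an identity between
  polynomial matrices be specialised to numbers, to polynomials on a line, or to power series.\<close>

context comm_semiring_hom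
begin

lemma mpoly_eval_eq_sum:
  assumes "finite A" "Poly_Mapping.keys q \<subseteq> A"
  shows "mpoly_eval hom z q = (\<Sum>\<alpha>\<in>A. hom (Poly_Mapping.lookup q \<alpha>) * monomial_value z \<alpha>)"
  unfolding mpoly_eval_def
  using assms by (intro sum.mono_neutral_left) (auto simp: in_keys_iff)

lemma mpoly_eval_0 [simp]: "mpoly_eval hom z 0 = 0"
  by (simp add: mpoly_eval_def)

lemma mpoly_eval_single [simp]:
  "mpoly_eval hom z (Poly_Mapping.single \<alpha> c) = hom c * monomial_value z \<alpha>"
  by (cases "c = 0") (simp_all add: mpoly_eval_def)

lemma mpoly_eval_add: "mpoly_eval hom z (p + q) = mpoly_eval hom z p + mpoly_eval hom z q"
proof -
  let ?A = "Poly_Mapping.keys p \<union> Poly_Mapping.keys q"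
  have *: "finite ?A" "Poly_Mapping.keys (p + q) \<subseteq> ?A"
    using Poly_Mapping.keys_add[of p q] by auto
  show ?thesis
    unfolding mpoly_eval_eq_sum[OF *]
      mpoly_eval_eq_sum[OF *(1) Un_upper1] mpoly_eval_eq_sum[OF *(1) Un_upper2]
    by (simp add: lookup_add hom_add algebra_simps sum.distrib)
qed

lemma mpoly_eval_sum: "mpoly_eval hom z (\<Sum>i\<in>I. p i) = (\<Sum>i\<in>I. mpoly_eval hom z (p i))"
  by (induction I rule: infinite_finite_induct) (auto simp: mpoly_eval_add)

lemma mpoly_eval_mult: "mpoly_eval hom z (p * q) = mpoly_eval hom z p * mpoly_eval hom z q"
proof -
  have expand: "r = (\<Sum>\<alpha>\<in>Poly_Mapping.keys r. Poly_Mapping.single \<alpha> (Poly_Mapping.lookup r \<alpha>))"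
    for r :: "(nat \<Rightarrow>\<^sub>0 nat) \<Rightarrow>\<^sub>0 'a"
    by (rule poly_mapping_eqI)
      (simp add: lookup_sum lookup_single when_def in_keys_iff sum.delta)
  have "mpoly_eval hom z (p * q) = mpoly_eval hom z
     ((\<Sum>\<alpha>\<in>Poly_Mapping.keys p. Poly_Mapping.single \<alpha> (Poly_Mapping.lookup p \<alpha>)) *
      (\<Sum>\<alpha>\<in>Poly_Mapping.keys q. Poly_Mapping.single \<alpha> (Poly_Mapping.lookup q \<alpha>)))"
    using expand[of p] expand[of q] by simp
  also have "\<dots> = mpoly_eval hom z p * mpoly_eval hom z q"
    by (simp add: sum_product mpoly_eval_sum mult_single hom_mult monomial_value_add
        mpoly_eval_def[of hom z p] mpoly_eval_def[of hom z q] mult_ac)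
  finally show ?thesis .
qed

end

lemma comm_semiring_hom_ident: "comm_semiring_hom (\<lambda>c::'k::comm_semiring_1. c)"
  by unfold_locales auto

lemma comm_semiring_hom_const_poly: "comm_semiring_hom (\<lambda>c::'k::comm_semiring_1. [:c:])"
  by unfold_locales (auto simp: one_pCons mult_ac)

text \<open>With affine \<open>z k\<close>, the inner evaluation is the restriction of \<open>q\<close> to a line, as a polynomial in the
  line parameter.\<close>
lemma poly_mpoly_eval:
  "poly (mpoly_eval (\<lambda>c. [:c:]) z q) h = mpoly_eval (\<lambda>c. c) (\<lambda>k. poly (z k) h) q"
  by (simp add: mpoly_eval_def poly_sum poly_monomial_value)

lemma base_digits_unique:
  fixes a b :: "nat \<Rightarrow> nat"
  assumes "\<And>k. k < n \<Longrightarrow> a k < N \<and> b k < N"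
    and "(\<Sum>k<n. a k * N ^ k) = (\<Sum>k<n. b k * N ^ k)"
  shows "\<forall>k<n. a k = b k"
  using assms
proof (induction n arbitrary: a b)
  case (Suc n)
  have split: "(\<Sum>k<Suc n. c k * N ^ k) = c 0 + N * (\<Sum>k<n. c (Suc k) * N ^ k)" for c :: "nat \<Rightarrow> nat"
    by (simp add: sum.lessThan_Suc_shift sum_distrib_left algebra_simps del: sum.lessThan_Suc)
  have eq: "a 0 + N * (\<Sum>k<n. a (Suc k) * N ^ k) = b 0 + N * (\<Sum>k<n. b (Suc k) * N ^ k)"
    using Suc.prems(2) unfolding split .
  have lt: "a 0 < N" "b 0 < N" using Suc.prems(1)[of 0] by auto
  have "(a 0 + N * (\<Sum>k<n. a (Suc k) * N ^ k)) mod N = (b 0 + N * (\<Sum>k<n. b (Suc k) * N ^ k)) mod N"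
    using eq by simp
  then have 0: "a 0 = b 0" using lt by simp
  then have "(\<Sum>k<n. a (Suc k) * N ^ k) = (\<Sum>k<n. b (Suc k) * N ^ k)" using eq lt by auto
  then have "\<forall>k<n. a (Suc k) = b (Suc k)"
    by (intro Suc.IH Suc.prems(1) Suc_mono)
  with 0 show ?case by (auto simp: less_Suc_eq_0_disj)
qed auto

text \<open>Kronecker substitution: with \<open>N\<close> larger than all exponents of \<open>q\<close>, replacing the \<open>k\<close>-th variable by
  \<open>x ^ (N ^ k)\<close> sends distinct monomials of \<open>q\<close> to distinct powers of \<open>x\<close>, because base-\<open>N\<close> digits
  are unique. The resulting polynomial in one variable is nonzero, so it has a nonroot.\<close>
lemma mpoly_nonzero_imp_nonroot:
  fixes q :: "(nat \<Rightarrow>\<^sub>0 nat) \<Rightarrow>\<^sub>0 'k::field_char_0"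
  assumes "q \<noteq> 0"
  obtains y where "mpoly_eval (\<lambda>c. c) y q \<noteq> 0"
proof -
  define S where "S = (\<Union>\<alpha>\<in>Poly_Mapping.keys q. Poly_Mapping.keys \<alpha>)"
  define n where "n = Suc (Max (insert 0 S))"
  define T where "T = (\<Union>\<alpha>\<in>Poly_Mapping.keys q. Poly_Mapping.range \<alpha>)"
  define N where "N = Suc (Max (insert 0 T))"
  have "finite S" "finite T" by (auto simp: S_def T_def)
  have n: "Poly_Mapping.keys \<alpha> \<subseteq> {..<n}" if "\<alpha> \<in> Poly_Mapping.keys q" for \<alpha>
  proof
    fix k assume "k \<in> Poly_Mapping.keys \<alpha>"
    then have "k \<in> insert 0 S" using that by (auto simp: S_def)
    then show "k \<in> {..<n}" using \<open>finite S\<close> by (simp add: n_def less_Suc_eq_le)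
  qed
  have N: "Poly_Mapping.lookup \<alpha> k < N" if "\<alpha> \<in> Poly_Mapping.keys q" for \<alpha> k
  proof -
    have "Poly_Mapping.lookup \<alpha> k = 0 \<or> Poly_Mapping.lookup \<alpha> k \<in> Poly_Mapping.range \<alpha>"
      by (cases "k \<in> Poly_Mapping.keys \<alpha>") (simp, simp add: in_keys_iff)
    then have "Poly_Mapping.lookup \<alpha> k \<in> insert 0 T" using that by (auto simp: T_def)
    then show ?thesis using \<open>finite T\<close> by (simp add: N_def less_Suc_eq_le)
  qed
  define e where "e \<alpha> = (\<Sum>k<n. Poly_Mapping.lookup \<alpha> k * N ^ k)" for \<alpha> :: "nat \<Rightarrow>\<^sub>0 nat"
  have inj: "\<alpha> = \<beta>" if "\<alpha> \<in> Poly_Mapping.keys q" "\<beta> \<in> Poly_Mapping.keys q" "e \<alpha> = e \<beta>" for \<alpha> \<beta>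
  proof (rule poly_mapping_eqI)
    fix k
    have "\<forall>k<n. Poly_Mapping.lookup \<alpha> k = Poly_Mapping.lookup \<beta> k"
      using base_digits_unique[of n "Poly_Mapping.lookup \<alpha>" N "Poly_Mapping.lookup \<beta>"] N that
      unfolding e_def by blast
    then show "Poly_Mapping.lookup \<alpha> k = Poly_Mapping.lookup \<beta> k"
      using n[OF that(1)] n[OF that(2)] by (cases "k < n") (auto, metis in_keys_iff lessThan_iff subsetD)
  qed
  define P where "P = mpoly_eval (\<lambda>c::'k. [:c:]) (\<lambda>k. monom 1 (N ^ k)) q"
  have mv: "monomial_value (\<lambda>k. monom (1::'k) (N ^ k)) \<alpha> = monom 1 (e \<alpha>)"
    if "\<alpha> \<in> Poly_Mapping.keys q" for \<alpha>
  proof -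
    have pm: "(\<Prod>k\<in>A. monom (1::'k) (f k)) = monom 1 (\<Sum>k\<in>A. f k)" if "finite A" for A :: "nat set" and f
      using that by (induction A) (auto simp: mult_monom)
    show ?thesis
      by (simp add: monomial_value_eq_prod[OF _ n[OF that]] monom_power pm e_def mult.commute)
  qed
  obtain \<alpha> where \<alpha>: "\<alpha> \<in> Poly_Mapping.keys q"
    using assms by (metis Poly_Mapping.keys_eq_empty equals0I)
  have "coeff P (e \<alpha>) = (\<Sum>\<beta>\<in>Poly_Mapping.keys q. if \<beta> = \<alpha> then Poly_Mapping.lookup q \<beta> else 0)"
    unfolding P_def mpoly_eval_def coeff_sum
    by (rule sum.cong) (use inj \<alpha> in \<open>auto simp: mv\<close>)
  also have "\<dots> \<noteq> 0" using \<alpha> by (simp add: in_keys_iff)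
  finally have "P \<noteq> 0" by auto
  then obtain h where "poly P h \<noteq> 0"
    using poly_all_0_iff_0[of P] by auto
  then show ?thesis using that unfolding P_def poly_mpoly_eval by blast
qed

text \<open>If \<open>P\<close> were nonzero, both \<open>P\<close> and the translate of \<open>q\<close> would be nonzero at some point each, hence
  nonzero polynomials on the line joining these two points, and so would be their product. A nonroot of
  the product contradicts the hypothesis.\<close>
lemma mpoly_eq_0_if_generically_0:
  fixes P q :: "(nat \<Rightarrow>\<^sub>0 nat) \<Rightarrow>\<^sub>0 'k::field_char_0"
  assumes "q \<noteq> 0"
    and "\<And>w. mpoly_eval (\<lambda>c. c) (\<lambda>k. a k + w k) q \<noteq> 0 \<Longrightarrow> mpoly_eval (\<lambda>c. c) w P = 0"
  shows "P = 0"
proof (rule ccontr)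
  assume "P \<noteq> 0"
  then obtain w0 where w0: "mpoly_eval (\<lambda>c. c) w0 P \<noteq> 0" by (rule mpoly_nonzero_imp_nonroot)
  obtain y where y: "mpoly_eval (\<lambda>c. c) y q \<noteq> 0" using assms(1) by (rule mpoly_nonzero_imp_nonroot)
  define d where "d k = y k - a k - w0 k" for k
  define A where "A = mpoly_eval (\<lambda>c. [:c:]) (\<lambda>k. [:a k + w0 k, d k:]) q"
  define C where "C = mpoly_eval (\<lambda>c. [:c:]) (\<lambda>k. [:w0 k, d k:]) P"
  have "poly A 1 \<noteq> 0" "poly C 0 \<noteq> 0"
    using y w0 by (auto simp: A_def C_def poly_mpoly_eval d_def)
  then have "A * C \<noteq> 0" by auto
  then obtain h where "poly (A * C) h \<noteq> 0" using poly_all_0_iff_0[of "A * C"] by auto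
  then show False
    using assms(2)[of "\<lambda>k. w0 k + h * d k"] by (auto simp: A_def C_def poly_mpoly_eval add.assoc)
qed

section \<open>Full column rank and left inverses\<close>

lemma (in vec_space) full_column_rank_imp_kernel_trivial:
  assumes A: "A \<in> carrier_mat n nc" and rank: "rank A = nc"
    and v: "v \<in> carrier_vec nc" "A *\<^sub>v v = 0\<^sub>v n"
  shows "v = 0\<^sub>v nc"
proof -
  \<comment> \<open>The rank counts the set of columns, so full rank also excludes repeated columns.\<close>
  obtain S where S: "maximal S (\<lambda>T. T \<subseteq> set (cols A) \<and> lin_indpt T)"
    using maximal_exists[of "(\<lambda>T. T \<subseteq> set (cols A) \<and> lin_indpt T)" "card (set (cols A))" "{}"]
    by (meson List.finite_set card_mono empty_iff empty_subsetI finite_lin_indpt2 rev_finite_subset)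
  have "card S \<le> card (set (cols A))"
    using S by (simp add: card_mono maximal_def)
  then have "nc \<le> card (set (cols A))"
    using rank_card_indpt[OF A S] rank by simp
  then have distinct: "distinct (cols A)"
    using A card_length[of "cols A"] by (intro card_distinct) auto
  show ?thesis
    using full_rank_lin_indpt[OF A rank distinct] lin_depI[OF A v(1) _ v(2) distinct] by blast
qed

text \<open>A matrix with trivial kernel is an injective linear map, and these have linear left inverses.
  Vectors are functions \<open>nat \<Rightarrow> 'f\<close>; the domain of injectivity is the subspace of those supported below \<open>m\<close>.\<close>
lemma left_inverse_of_trivial_kernel:
  fixes B :: "nat \<Rightarrow> nat \<Rightarrow> 'f::field"
  assumes kernel: "\<And>v. (\<And>i. i < t \<Longrightarrow> (\<Sum>j<m. B i j * v j) = 0) \<Longrightarrow> (\<And>j. j < m \<Longrightarrow> v j = 0)"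
  obtains D where "\<And>l j. l < m \<Longrightarrow> j < m \<Longrightarrow> (\<Sum>i<t. D l i * B i j) = (if l = j then 1 else 0)"
proof -
  define scale where "scale = (\<lambda>(c::'f) (v::nat \<Rightarrow> 'f) i. c * v i)"
  interpret vs: vector_space scale
    by (rule Vector_Spaces.vector_space.intro) (auto simp: scale_def fun_eq_iff algebra_simps)
  interpret vp: vector_space_pair scale scale ..
  have sum_fun: "(\<Sum>i\<in>I. F i) x = (\<Sum>i\<in>I. F i x)" for I :: "nat set" and F :: "nat \<Rightarrow> nat \<Rightarrow> 'f" and x
    by (induction I rule: infinite_finite_induct) auto
  define f where "f v = (\<lambda>i. if i < t then \<Sum>j<m. B i j * v j else 0)" for v
  define V where "V = {v :: nat \<Rightarrow> 'f. \<forall>j\<ge>m. v j = 0}"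
  define e where "e i = (\<lambda>k. if k = i then 1 else 0 :: 'f)" for i :: nat
  have lin: "Vector_Spaces.linear scale scale f"
    unfolding Vector_Spaces.linear_iff
    by (auto simp: vs.vector_space_axioms[unfolded scale_def] f_def scale_def fun_eq_iff algebra_simps sum.distrib
        sum_distrib_left)
  have sub: "vs.subspace V"
    by (rule vs.subspaceI) (simp_all add: V_def scale_def)
  have "inj_on f V"
  proof (rule inj_onI)
    fix u v assume *: "u \<in> V" "v \<in> V" "f u = f v"
    have "(u - v) j = 0" if "j < m" for j
    proof (rule kernel[OF _ that])
      fix i assume "i < t"
      then show "(\<Sum>j<m. B i j * (u - v) j) = 0"
        using fun_cong[OF *(3), of i] by (simp add: f_def algebra_simps sum_subtractf)
    qed
    then show "u = v" using * by (auto simp: V_def fun_eq_iff) (metis not_le)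
  qed
  then obtain g where g: "Vector_Spaces.linear scale scale g" "\<And>v. v \<in> V \<Longrightarrow> g (f v) = v"
    using vp.linear_exists_left_inverse_on[OF lin sub] by blast
  interpret g: Vector_Spaces.linear scale scale g by (rule g(1))
  show ?thesis
  proof (rule that[of "\<lambda>l i. g (e i) l"])
    fix l j assume "l < m" "j < m"
    have "f (e j) = (\<Sum>i<t. scale (B i j) (e i))"
      using \<open>j < m\<close>
      by (auto simp: fun_eq_iff sum_fun f_def e_def scale_def if_distrib cong: if_cong)
    then have "g (f (e j)) l = (\<Sum>i<t. B i j * g (e i) l)"
      by (simp add: g.sum g.scale sum_fun) (simp add: scale_def)
    moreover have "g (f (e j)) = e j"
      using \<open>j < m\<close> by (intro g(2)) (auto simp: V_def e_def)
    ultimately show "(\<Sum>i<t. g (e i) l * B i j) = (if l = j then 1 else 0)"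
      by (simp add: e_def mult.commute)
  qed
qed

lemma common_denominator:
  fixes x :: "'i \<Rightarrow> 'a::idom fract"
  assumes "finite I"
  shows "\<exists>q n. q \<noteq> 0 \<and> (\<forall>i\<in>I. to_fract q * x i = to_fract (n i))"
  using assms
proof induction
  case empty
  show ?case by (intro exI[of _ 1]) auto
next
  case (insert i I)
  then obtain q n where q: "q \<noteq> 0" "\<And>i. i \<in> I \<Longrightarrow> to_fract q * x i = to_fract (n i)" by blast
  obtain a b where ab: "x i = Fraction_Field.Fract a b" "b \<noteq> 0" by (cases "x i")
  have "to_fract b * x i = to_fract a"
    using ab by (simp add: to_fract_def eq_fract)
  then show ?case using q ab insert.hyps
    by (intro exI[of _ "b * q"] exI[of _ "\<lambda>k. if k = i then q * a else b * n k"])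
      (auto simp: algebra_simps simp flip: q(2))
qed

lemma full_column_rank_imp_scaled_left_inverse:
  fixes B :: "nat \<Rightarrow> nat \<Rightarrow> 'a::idom"
  assumes "vec_space.rank t (mat t m (\<lambda>(i, j). to_fract (B i j))) = m"
  obtains q D where "q \<noteq> 0"
    "\<And>l j. l < m \<Longrightarrow> j < m \<Longrightarrow> (\<Sum>i<t. D l i * B i j) = (if l = j then q else 0)"
proof -
  let ?A = "mat t m (\<lambda>(i, j). to_fract (B i j))"
  have kernel: "v j = 0"
    if "\<And>i. i < t \<Longrightarrow> (\<Sum>j<m. to_fract (B i j) * v j) = 0" "j < m" for v j
  proof -
    have "?A *\<^sub>v vec m v = 0\<^sub>v t"
      using that(1) by (intro eq_vecI) (auto simp: scalar_prod_def lessThan_atLeast0)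
    then have "vec m v = 0\<^sub>v m"
      using vec_space.full_column_rank_imp_kernel_trivial[OF _ assms, of "vec m v"] by simp
    then show "v j = 0"
      using \<open>j < m\<close> by (metis index_vec index_zero_vec(1))
  qed
  obtain D where D: "\<And>l j. l < m \<Longrightarrow> j < m \<Longrightarrow>
      (\<Sum>i<t. D l i * to_fract (B i j)) = (if l = j then 1 else 0)"
    using left_inverse_of_trivial_kernel[where t = t and m = m and B = "\<lambda>i j. to_fract (B i j)"] kernel by blast
  obtain q n where q: "q \<noteq> 0"
    and n: "\<forall>p\<in>{..<m} \<times> {..<t}. to_fract q * (case p of (l, i) \<Rightarrow> D l i) = to_fract (n p)"
    using common_denominator[of "{..<m} \<times> {..<t}" "\<lambda>(l, i). D l i"] by auto
  have sum_fract: "to_fract (\<Sum>i\<in>I. h i) = (\<Sum>i\<in>I. to_fract (h i))" for I :: "nat set" and h :: "nat \<Rightarrow> 'a"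
    by (induction I rule: infinite_finite_induct) auto
  show ?thesis
  proof (rule that[OF q, of "\<lambda>l i. n (l, i)"])
    fix l j assume lj: "l < m" "j < m"
    have "to_fract (\<Sum>i<t. n (l, i) * B i j) = (\<Sum>i<t. to_fract q * D l i * to_fract (B i j))"
      using n lj by (auto simp: sum_fract intro!: sum.cong)
    also have "\<dots> = to_fract q * (\<Sum>i<t. D l i * to_fract (B i j))"
      by (simp add: sum_distrib_left mult.assoc)
    also have "\<dots> = to_fract (if l = j then q else 0)"
      using D[OF lj] by simp
    finally show "(\<Sum>i<t. n (l, i) * B i j) = (if l = j then q else 0)"
      by (simp only: to_fract_eq_iff)
  qed
qed

text \<open>This is how the identity \<open>D B = q I\<close> is used: it multiplies every kernel vector of \<open>B\<close> by \<open>q\<close> to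
  zero. It is applied after specialisation, to rows of \<open>D\<close>, over power series and over numbers.\<close>
lemma scaled_left_inverse_cancel:
  fixes q :: "'r::comm_ring_1" and m t l :: nat
  assumes "\<And>j. j < m \<Longrightarrow> (\<Sum>i<t. D i * B i j) = (if l = j then q else 0)"
    and "\<And>i. i < t \<Longrightarrow> (\<Sum>j<m. B i j * g j) = 0"
    and "l < m"
  shows "q * g l = 0"
proof -
  have "q * g l = (\<Sum>j<m. (if l = j then q else 0) * g j)"
    using \<open>l < m\<close> by (simp add: if_distrib[of "\<lambda>x. x * _"] cong: if_cong)
  also have "\<dots> = (\<Sum>j<m. (\<Sum>i<t. D i * B i j) * g j)"
    using assms(1) by (intro sum.cong) auto
  also have "\<dots> = (\<Sum>i<t. D i * (\<Sum>j<m. B i j * g j))"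
    unfolding sum_distrib_left sum_distrib_right by (subst sum.swap) (simp add: mult.assoc)
  also have "\<dots> = 0" using assms(2) by simp
  finally show ?thesis .
qed

section \<open>Restricting a power series to a line\<close>

definition exponents :: "nat \<Rightarrow> nat \<Rightarrow> (nat \<Rightarrow>\<^sub>0 nat) set" where
  "exponents s n = {\<alpha>. Poly_Mapping.keys \<alpha> \<subseteq> {..<s} \<and> (\<Sum>k<s. Poly_Mapping.lookup \<alpha> k) = n}"

lemma finite_exponents: "finite (exponents s n)"
proof -
  have "Poly_Mapping.lookup ` exponents s n \<subseteq>
      {f. \<forall>x. (x \<in> {..<s} \<longrightarrow> f x \<in> {..n}) \<and> (x \<notin> {..<s} \<longrightarrow> f x = 0)}"
    by (auto simp: exponents_def in_keys_iff intro!: member_le_sum)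
  then have "finite (Poly_Mapping.lookup ` exponents s n)"
    by (rule finite_subset) (intro finite_set_of_finite_funs; simp)
  then show ?thesis
    by (rule finite_imageD) (rule inj_onI, simp add: poly_mapping.lookup_inject)
qed

lemma zero_in_exponents: "0 \<in> exponents s n \<longleftrightarrow> n = 0"
  by (auto simp: exponents_def)

lemma single_in_exponents: "k < s \<Longrightarrow> Poly_Mapping.single k 1 \<in> exponents s n \<longleftrightarrow> n = 1"
  by (auto simp: exponents_def lookup_single when_def)

lemma add_in_exponents:
  "\<alpha> + \<beta> \<in> exponents s n \<longleftrightarrow>
     (\<exists>i\<le>n. \<alpha> \<in> exponents s i \<and> \<beta> \<in> exponents s (n - i))"
proof -
  have "Poly_Mapping.keys (\<alpha> + \<beta>) = Poly_Mapping.keys \<alpha> \<union> Poly_Mapping.keys \<beta>"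
    by (auto simp: in_keys_iff lookup_add)
  then show ?thesis
    by (auto simp: exponents_def lookup_add sum.distrib)
qed

text \<open>The series \<open>F (h w)\<close> in the variable \<open>h\<close>: its \<open>n\<close>-th coefficient is the homogeneous part of \<open>F\<close> of
  degree \<open>n\<close>, evaluated at \<open>w\<close>.\<close>
definition restrict_to_line ::
  "nat \<Rightarrow> (nat \<Rightarrow> 'k::field) \<Rightarrow> 'k power_series \<Rightarrow> 'k fps" where
  "restrict_to_line s w F = Abs_fps (\<lambda>n. \<Sum>\<alpha>\<in>exponents s n. F \<alpha> * monomial_value w \<alpha>)"

lemma restrict_to_line_nth:
  "fps_nth (restrict_to_line s w F) n = (\<Sum>\<alpha>\<in>exponents s n. F \<alpha> * monomial_value w \<alpha>)"
  by (simp add: restrict_to_line_def)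

lemma restrict_to_line_sum:
  "restrict_to_line s w (\<lambda>\<alpha>. \<Sum>i\<in>I. F i \<alpha>) = (\<Sum>i\<in>I. restrict_to_line s w (F i))"
  by (rule fps_ext)
    (simp add: restrict_to_line_nth fps_sum_nth sum_distrib_right sum.swap[of _ I])

lemma restrict_to_line_scale:
  "restrict_to_line s w (\<lambda>\<alpha>. c * F \<alpha>) = fps_const c * restrict_to_line s w F"
  by (rule fps_ext) (simp add: restrict_to_line_nth sum_distrib_left mult.assoc)

lemma restrict_to_line_mult:
  "restrict_to_line s w (ps_mult F G) = restrict_to_line s w F * restrict_to_line s w G"
proof (rule fps_ext)
  fix n
  let ?f = "\<lambda>(\<alpha>, \<beta>). (F \<alpha> * monomial_value w \<alpha>) * (G \<beta> * monomial_value w \<beta>)"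
  let ?S = "\<lambda>\<gamma>. {(\<alpha>, \<beta>). \<alpha> + \<beta> = \<gamma>} :: ((nat \<Rightarrow>\<^sub>0 nat) \<times> (nat \<Rightarrow>\<^sub>0 nat)) set"
  let ?T = "\<lambda>i. exponents s i \<times> exponents s (n - i)"
  have fin: "finite (?S \<gamma>)" if "\<gamma> \<in> exponents s n" for \<gamma>
  proof (rule finite_subset)
    show "?S \<gamma> \<subseteq> (\<Union>i\<le>n. ?T i)"
      using that by (auto simp: add_in_exponents)
  qed (auto simp: finite_exponents)
  have "fps_nth (restrict_to_line s w (ps_mult F G)) n = (\<Sum>\<gamma>\<in>exponents s n. \<Sum>p\<in>?S \<gamma>. ?f p)"
    unfolding restrict_to_line_nth ps_mult_def
    unfolding sum_distrib_right
    by (intro sum.cong refl) (auto simp: monomial_value_add mult_ac)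
  also have "\<dots> = (\<Sum>(\<gamma>, p)\<in>Sigma (exponents s n) ?S. ?f p)"
    by (intro sum.Sigma finite_exponents ballI fin)
  also have "\<dots> = (\<Sum>(i, p)\<in>Sigma {0..n} ?T. ?f p)"
    by (rule sum.reindex_bij_witness[
          where i = "\<lambda>(i, p). (fst p + snd p, p)"
            and j = "\<lambda>(\<gamma>, p). (\<Sum>k<s. Poly_Mapping.lookup (fst p) k, p)"])
      (auto simp: add_in_exponents, auto simp: exponents_def)
  also have "\<dots> = (\<Sum>i=0..n. \<Sum>p\<in>?T i. ?f p)"
    by (intro sum.Sigma[symmetric]) (auto simp: finite_exponents)
  also have "\<dots> = fps_nth (restrict_to_line s w F * restrict_to_line s w G) n"
    by (simp add: fps_mult_nth restrict_to_line_nth sum_product sum.cartesian_product)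
  finally show "fps_nth (restrict_to_line s w (ps_mult F G)) n =
      fps_nth (restrict_to_line s w F * restrict_to_line s w G) n" .
qed

lemma restrict_to_line_coord:
  assumes "k < s"
  shows "restrict_to_line s w (ps_coord a k) = fps_of_poly [:a, w k:]"
proof (rule fps_ext)
  fix n
  have ne: "Poly_Mapping.single k (1::nat) \<noteq> 0"
    by (metis lookup_single_eq lookup_zero one_neq_zero)
  have "fps_nth (restrict_to_line s w (ps_coord a k)) n =
      (\<Sum>\<alpha>\<in>exponents s n. (if \<alpha> = 0 then a else 0) +
         (if \<alpha> = Poly_Mapping.single k 1 then w k else 0))"
    unfolding restrict_to_line_nth ps_coord_def using ne by (intro sum.cong) auto
  also have "\<dots> = (if n = 0 then a else 0) + (if n = 1 then w k else 0)"
    using assms by (simp add: sum.distrib finite_exponents zero_in_exponents single_in_exponents del: One_nat_def)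
  also have "\<dots> = fps_nth (fps_of_poly [:a, w k:]) n"
    by (auto simp: coeff_pCons split: nat.splits)
  finally show "fps_nth (restrict_to_line s w (ps_coord a k)) n = fps_nth (fps_of_poly [:a, w k:]) n" .
qed

lemma mpoly_eval_bracket_poly:
  assumes "comm_semiring_hom \<phi>"
  shows "mpoly_eval \<phi> z (bracket_poly c s i j) = (\<Sum>k<s. \<phi> (c i j k) * z k)"
proof -
  interpret comm_semiring_hom \<phi> by (rule assms)
  show ?thesis by (simp add: bracket_poly_def mpoly_eval_sum)
qed

lemma restrict_to_line_bracket:
  "restrict_to_line s w (ps_bracket c s a i j) =
     fps_of_poly (mpoly_eval (\<lambda>c. [:c:]) (\<lambda>k. [:a k, w k:]) (bracket_poly c s i j))"
  unfolding ps_bracket_def restrict_to_line_sum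
    mpoly_eval_bracket_poly[OF comm_semiring_hom_const_poly]
    fps_of_poly_sum
  by (intro sum.cong refl)
    (simp add: restrict_to_line_scale restrict_to_line_coord fps_of_poly_mult fps_of_poly_const
      del: mult_pCons_left)

section \<open>Formal invariants\<close>

lemma sum_lessThan_split:
  fixes f :: "nat \<Rightarrow> 'r::comm_monoid_add"
  assumes "t \<le> s"
  shows "(\<Sum>j<s. f j) = (\<Sum>j<t. f j) + (\<Sum>j<s-t. f (t + j))"
proof -
  have "(\<Sum>j<t + d. f j) = (\<Sum>j<t. f j) + (\<Sum>j<d. f (t + j))" for d
    by (induction d) (simp_all add: add.assoc)
  from this[of "s - t"] show ?thesis using assms by simp
qed

text \<open>On a line whose direction \<open>w\<close> avoids the zeros of \<open>q\<close> translated to the centre, \<open>q\<close> is a nonzero series, so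
  it can be cancelled and the derivative vanishes on that line. Each homogeneous part of the
  derivative is a polynomial that vanishes at all such \<open>w\<close>, hence is zero.\<close>
lemma formal_invariant_depends_only:
  fixes c :: "nat \<Rightarrow> nat \<Rightarrow> nat \<Rightarrow> 'k::field_char_0"
  assumes "t \<le> s"
    and abelian: "\<And>i j k. i < t \<Longrightarrow> j < t \<Longrightarrow> c i j k = 0"
    and "q \<noteq> 0"
    and inverse: "\<And>l j. l < s - t \<Longrightarrow> j < s - t \<Longrightarrow>
        (\<Sum>i<t. D l i * bracket_poly c s i (t + j)) = (if l = j then q else 0)"
    and F: "power_series_in s F" "formal_invariant c s a F"
  shows "formal_depends_only t s F"
  unfolding formal_depends_only_def
proof (intro ballI allI)
  fix j0 \<alpha> assume "j0 \<in> {t..<s}"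
  define l where "l = j0 - t"
  have l: "l < s - t" "j0 = t + l" using \<open>j0 \<in> {t..<s}\<close> by (auto simp: l_def)
  define G where "G = ps_partial j0 F"
  interpret P: comm_semiring_hom "\<lambda>c::'k. [:c:]" by (rule comm_semiring_hom_const_poly)
  have generic: "restrict_to_line s w G = 0" if w: "mpoly_eval (\<lambda>c. c) (\<lambda>k. a k + w k) q \<noteq> 0" for w
  proof -
    define \<psi> where "\<psi> p = fps_of_poly (mpoly_eval (\<lambda>c. [:c:]) (\<lambda>k. [:a k, w k:]) p)" for p
    have "\<psi> q * restrict_to_line s w (ps_partial (t + l) F) = 0"
    proof (rule scaled_left_inverse_cancel[OF _ _ l(1)])
      fix j assume "j < s - t"
      have "(\<Sum>i<t. \<psi> (D l i) * \<psi> (bracket_poly c s i (t + j))) =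
          \<psi> (\<Sum>i<t. D l i * bracket_poly c s i (t + j))"
        by (simp add: \<psi>_def P.mpoly_eval_sum P.mpoly_eval_mult fps_of_poly_sum fps_of_poly_mult)
      then show "(\<Sum>i<t. \<psi> (D l i) * \<psi> (bracket_poly c s i (t + j))) = (if l = j then \<psi> q else 0)"
        using inverse[OF l(1) \<open>j < s - t\<close>] by (simp add: \<psi>_def)
    next
      fix i assume "i < t"
      have zero: "\<psi> (bracket_poly c s i j) = 0" if "j < t" for j
        using abelian[OF \<open>i < t\<close> that] by (simp add: bracket_poly_def \<psi>_def)
      have "(\<lambda>\<alpha>. \<Sum>j<s. ps_mult (ps_bracket c s a i j) (ps_partial j F) \<alpha>) = (\<lambda>\<alpha>. 0)"
        using F(2) \<open>i < t\<close> \<open>t \<le> s\<close> by (auto simp: formal_invariant_def)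
      then have "restrict_to_line s w (\<lambda>\<alpha>. \<Sum>j<s. ps_mult (ps_bracket c s a i j) (ps_partial j F) \<alpha>) = 0"
        by (simp add: restrict_to_line_def fps_eq_iff)
      then have "(\<Sum>j<s. \<psi> (bracket_poly c s i j) * restrict_to_line s w (ps_partial j F)) = 0"
        by (simp add: restrict_to_line_sum restrict_to_line_mult restrict_to_line_bracket \<psi>_def)
      then show "(\<Sum>j<s - t. \<psi> (bracket_poly c s i (t + j)) *
          restrict_to_line s w (ps_partial (t + j) F)) = 0"
        using zero by (simp add: sum_lessThan_split[OF \<open>t \<le> s\<close>])
    qed
    moreover have "\<psi> q \<noteq> 0"
    proof
      assume "\<psi> q = 0"
      then have "mpoly_eval (\<lambda>c. [:c:]) (\<lambda>k. [:a k, w k:]) q = 0"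
        by (simp add: \<psi>_def fps_of_poly_eq_iff flip: fps_of_poly_0)
      then have "poly (mpoly_eval (\<lambda>c. [:c:]) (\<lambda>k. [:a k, w k:]) q) 1 = 0" by simp
      then show False using w by (simp add: poly_mpoly_eval)
    qed
    ultimately show ?thesis by (simp add: G_def l(2))
  qed
  show "ps_partial j0 F \<alpha> = 0"
  proof (cases "Poly_Mapping.keys \<alpha> \<subseteq> {..<s}")
    case True
    define n where "n = (\<Sum>k<s. Poly_Mapping.lookup \<alpha> k)"
    have \<alpha>: "\<alpha> \<in> exponents s n" using True by (simp add: exponents_def n_def)
    define P where "P = (\<Sum>\<beta>\<in>exponents s n. Poly_Mapping.single \<beta> (G \<beta>))"
    have eval_P: "mpoly_eval (\<lambda>c. c) w P = fps_nth (restrict_to_line s w G) n" for w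
      by (simp add: P_def restrict_to_line_nth comm_semiring_hom.mpoly_eval_sum[OF comm_semiring_hom_ident]
          comm_semiring_hom.mpoly_eval_single[OF comm_semiring_hom_ident])
    have "P = 0"
      by (rule mpoly_eq_0_if_generically_0[OF \<open>q \<noteq> 0\<close>, of a]) (simp add: eval_P generic)
    moreover have "Poly_Mapping.lookup P \<alpha> = G \<alpha>"
      using \<alpha> by (simp add: P_def lookup_sum lookup_single when_def finite_exponents)
    ultimately show ?thesis by (simp add: G_def)
  next
    case False
    then have "\<not> Poly_Mapping.keys (\<alpha> + Poly_Mapping.single j0 1) \<subseteq> {..<s}"
      by (auto simp: in_keys_iff lookup_add subset_iff)
    then show ?thesis using F(1) by (auto simp: power_series_in_def ps_partial_def)
  qed
qed

section \<open>Differentiability along lines in the dual space\<close>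

lemma dual_space_add_scaled:
  assumes "f \<in> dual_space smul" "g \<in> dual_space smul"
  shows "(\<lambda>v. f v + h * g v) \<in> dual_space smul"
  using assms by (simp add: dual_space_def Vector_Spaces.linear_iff algebra_simps)

text \<open>Some element \<open>p\<close> of the dual space is needed as a witness that \<open>smul\<close> is a vector space.\<close>
lemma dual_space_sum:
  assumes "finite A" "p \<in> dual_space smul" "\<And>k. k \<in> A \<Longrightarrow> g k \<in> dual_space smul"
  shows "(\<lambda>v. \<Sum>k\<in>A. w k * g k v) \<in> dual_space smul"
  using assms
  by (auto simp: dual_space_def Vector_Spaces.linear_iff algebra_simps sum.distrib sum_distrib_left
      intro!: sum.cong)

text \<open>The plane spanned by two functionals through \<open>p\<close> is parametrised continuously for pointwise
  convergence, so a neighbourhood of \<open>p\<close> in it lies in the open set \<open>U\<close>.\<close>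
lemma dual_domain_contains_plane_disc:
  fixes smul :: "'k::real_normed_field \<Rightarrow> 'v::ab_group_add \<Rightarrow> 'v"
  assumes U: "dual_domain smul U" and "p \<in> U"
    and g: "g \<in> dual_space smul" "e \<in> dual_space smul"
  obtains \<rho> where "\<rho> > 0"
    "\<And>h \<epsilon>. norm h < \<rho> \<Longrightarrow> norm \<epsilon> < \<rho> \<Longrightarrow> (\<lambda>v. p v + h * g v + \<epsilon> * e v) \<in> U"
proof -
  obtain T where T: "open T" "U = dual_space smul \<inter> T"
    using U by (auto simp: dual_domain_def openin_open)
  define m where "m = (\<lambda>(h, \<epsilon>) v. p v + h * g v + \<epsilon> * e v)"
  have "continuous_on UNIV m"
    unfolding m_def case_prod_beta
    by (intro continuous_on_coordinatewise_then_product continuous_intros)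
  then have "open (m -` T)"
    using T(1) by (simp add: open_vimage)
  moreover have "0 \<in> m -` T"
    using \<open>p \<in> U\<close> T(2) by (simp add: m_def zero_prod_def)
  ultimately obtain \<delta> where \<delta>: "\<delta> > 0" "ball 0 \<delta> \<subseteq> m -` T"
    by (meson openE)
  show ?thesis
  proof (rule that[of "\<delta> / 2"])
    fix h \<epsilon> :: 'k assume "norm h < \<delta> / 2" "norm \<epsilon> < \<delta> / 2"
    then have "norm (h, \<epsilon>) < \<delta>"
      using norm_Pair_le[of h \<epsilon>] by linarith
    then have "m (h, \<epsilon>) \<in> T" using \<delta>(2) by (auto simp: subset_iff)
    moreover have "m (h, \<epsilon>) \<in> dual_space smul"
      using \<open>p \<in> U\<close> T(2) g by (auto simp: m_def intro!: dual_space_add_scaled)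
    ultimately show "(\<lambda>v. p v + h * g v + \<epsilon> * e v) \<in> U"
      using T(2) by (simp add: m_def)
  qed (use \<delta> in simp)
qed

text \<open>Grouping the terms of an unconditionally convergent power series by total degree turns it, on a
  line, into an ordinary power series in the line parameter.\<close>
lemma has_sum_group_by_degree:
  fixes a :: "'k::real_normed_field power_series"
  assumes "((\<lambda>\<alpha>. a \<alpha> * (\<Prod>k<s. (h * w k) ^ Poly_Mapping.lookup \<alpha> k)) has_sum S)
             {\<alpha>. Poly_Mapping.keys \<alpha> \<subseteq> {..<s}}"
  shows "(\<lambda>n. fps_nth (restrict_to_line s w a) n * h ^ n) sums S"
proof -
  let ?f = "\<lambda>\<alpha>. a \<alpha> * (\<Prod>k<s. (h * w k) ^ Poly_Mapping.lookup \<alpha> k)"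
  have img: "snd ` Sigma UNIV (exponents s) = {\<alpha>. Poly_Mapping.keys \<alpha> \<subseteq> {..<s}}"
    by (force simp: exponents_def image_iff)
  have inj: "inj_on snd (Sigma UNIV (exponents s))"
    by (auto simp: inj_on_def exponents_def)
  have "((?f \<circ> snd) has_sum S) (Sigma UNIV (exponents s))"
    using assms unfolding has_sum_reindex[OF inj, symmetric] img .
  then have "((\<lambda>n. \<Sum>\<alpha>\<in>exponents s n. ?f \<alpha>) has_sum S) UNIV"
    by (rule has_sum_SigmaD) (simp add: has_sum_finite finite_exponents)
  then have "(\<lambda>n. \<Sum>\<alpha>\<in>exponents s n. ?f \<alpha>) sums S"
    by (rule has_sum_imp_sums)
  moreover have "(\<Sum>\<alpha>\<in>exponents s n. ?f \<alpha>) = fps_nth (restrict_to_line s w a) n * h ^ n" for n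
  proof -
    have "?f \<alpha> = a \<alpha> * monomial_value w \<alpha> * h ^ n" if "\<alpha> \<in> exponents s n" for \<alpha>
      using that by (simp add: exponents_def monomial_value_eq_prod[of "{..<s}"]
          power_mult_distrib prod.distrib mult_ac flip: power_sum)
    then show ?thesis unfolding restrict_to_line_nth sum_distrib_right by (intro sum.cong refl)
  qed
  ultimately show ?thesis by simp
qed

lemma analytic_differentiable_along_line_at_0:
  fixes smul :: "'k::{real_normed_field, banach} \<Rightarrow> 'v::ab_group_add \<Rightarrow> 'v"
  assumes U: "dual_domain smul U" and F: "analytic_in_coords s X U F"
    and "p \<in> U" and g: "g \<in> dual_space smul"
  shows "(\<lambda>h. F (\<lambda>v. p v + h * g v)) field_differentiable (at 0)"
proof -
  obtain \<rho> where \<rho>: "\<rho> > 0" "\<And>h. norm h < \<rho> \<Longrightarrow> (\<lambda>v. p v + h * g v) \<in> U"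
  proof (rule dual_domain_contains_plane_disc[OF U \<open>p \<in> U\<close> g g])
    fix \<rho> :: real
    assume \<rho>: "\<rho> > 0" and disc: "\<And>h \<epsilon>. norm h < \<rho> \<Longrightarrow> norm \<epsilon> < \<rho> \<Longrightarrow>
        (\<lambda>v. p v + h * g v + \<epsilon> * g v) \<in> U"
    show thesis
      by (rule that[OF \<rho>]) (use disc[of _ 0] \<rho> in simp)
  qed
  obtain r a where r: "r > 0" and a: "\<And>f. f \<in> U \<Longrightarrow> (\<forall>k<s. norm (f (X k) - p (X k)) < r) \<Longrightarrow>
      ((\<lambda>\<alpha>. a \<alpha> * (\<Prod>k<s. (f (X k) - p (X k)) ^ Poly_Mapping.lookup \<alpha> k)) has_sum F f)
        {\<alpha>. Poly_Mapping.keys \<alpha> \<subseteq> {..<s}}"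
    using F \<open>p \<in> U\<close> unfolding analytic_in_coords_def by meson
  \<comment> \<open>\<open>M\<close> bounds the coordinates of \<open>g\<close>, so \<open>norm h < r / M\<close> keeps the line inside the polydisc of
      convergence around \<open>p\<close>.\<close>
  define M where "M = 1 + (\<Sum>k<s. norm (g (X k)))"
  have "M > 0" unfolding M_def by (simp add: add_pos_nonneg sum_nonneg)
  define \<delta> where "\<delta> = min \<rho> (r / M)"
  have "\<delta> > 0" using \<rho> r \<open>M > 0\<close> by (simp add: \<delta>_def)
  define b where "b = fps_nth (restrict_to_line s (\<lambda>k. g (X k)) a)"
  have sums: "(\<lambda>n. b n * h ^ n) sums F (\<lambda>v. p v + h * g v)" if "norm h < \<delta>" for h
  proof -
    have "norm (h * g (X k)) < r" if "k < s" for k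
    proof -
      have "norm (g (X k)) \<le> (\<Sum>k<s. norm (g (X k)))"
        using that by (intro member_le_sum) auto
      then have "norm (g (X k)) \<le> M" by (simp add: M_def)
      then have "norm (h * g (X k)) \<le> norm h * M" by (simp add: norm_mult mult_left_mono)
      also have "\<dots> < r" using \<open>norm h < \<delta>\<close> \<open>M > 0\<close> by (simp add: \<delta>_def field_simps)
      finally show ?thesis .
    qed
    then have "((\<lambda>\<alpha>. a \<alpha> * (\<Prod>k<s. (h * g (X k)) ^ Poly_Mapping.lookup \<alpha> k)) has_sum
        F (\<lambda>v. p v + h * g v)) {\<alpha>. Poly_Mapping.keys \<alpha> \<subseteq> {..<s}}"
      using a[OF \<rho>(2)[of h]] that by (simp add: \<delta>_def)
    then show ?thesis unfolding b_def by (rule has_sum_group_by_degree)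
  qed
  have "summable (\<lambda>n. b n * of_real (\<delta> / 2) ^ n)"
    using sums[of "of_real (\<delta> / 2)"] \<open>\<delta> > 0\<close> by (auto simp: sums_iff)
  then have "((\<lambda>h. suminf (\<lambda>n. b n * h ^ n)) has_field_derivative suminf (\<lambda>n. diffs b n * 0 ^ n)) (at 0)"
    using \<open>\<delta> > 0\<close> by (intro termdiffs_strong) auto
  then have "((\<lambda>h. F (\<lambda>v. p v + h * g v)) has_field_derivative suminf (\<lambda>n. diffs b n * 0 ^ n)) (at 0)"
    by (rule has_field_derivative_transform_within_open[where S = "ball 0 \<delta>"])
      (use \<open>\<delta> > 0\<close> sums in \<open>auto simp: sums_iff\<close>)
  then show ?thesis by (auto simp: field_differentiable_def)
qed

lemma analytic_has_derivative_along_line: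
  fixes smul :: "'k::{real_normed_field, banach} \<Rightarrow> 'v::ab_group_add \<Rightarrow> 'v"
  assumes U: "dual_domain smul U" and F: "analytic_in_coords s X U F"
    and p: "(\<lambda>v. p v + h * g v) \<in> U" and g: "g \<in> dual_space smul"
  shows "((\<lambda>h. F (\<lambda>v. p v + h * g v)) has_field_derivative
            deriv (\<lambda>\<epsilon>. F (\<lambda>v. (p v + h * g v) + \<epsilon> * g v)) 0) (at h)"
proof -
  have "((\<lambda>\<epsilon>. F (\<lambda>v. (p v + h * g v) + \<epsilon> * g v)) has_field_derivative
            deriv (\<lambda>\<epsilon>. F (\<lambda>v. (p v + h * g v) + \<epsilon> * g v)) 0) (at 0)"
    using analytic_differentiable_along_line_at_0[OF U F p g]
    by (simp add: field_differentiable_derivI)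
  then show ?thesis
    using DERIV_shift[of "\<lambda>h. F (\<lambda>v. p v + h * g v)" _ 0 h] by (simp add: algebra_simps)
qed

section \<open>Dual basis and structure constants\<close>

context abelian_decomposition
begin

lemma span_X: "span (X ` {..<s}) = UNIV"
proof -
  have "v \<in> span (X ` {..<s})" for v
  proof -
    obtain a b where ab: "a \<in> L1" "b \<in> L2" "v = a + b"
      using sum_L1_L2 by blast
    have "X ` {t..<s} \<subseteq> X ` {..<s}" "X ` {..<t} \<subseteq> X ` {..<s}"
      using t_le_s by auto
    then have "L1 \<subseteq> span (X ` {..<s})" "L2 \<subseteq> span (X ` {..<s})"
      using span_L1 span_L2 span_mono by blast+
    then show ?thesis using ab by (auto intro: span_add)
  qed
  then show ?thesis by auto
qed

lemma dual_basis_in_dual_space: "dual_basis smul s X j \<in> dual_space smul"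
  using representation_add[OF independent_X] representation_scale[OF independent_X] vector_space_axioms
  by (simp add: dual_space_def dual_basis_def Vector_Spaces.linear_iff span_X
      vector_space_over_itself.vector_space_axioms)

lemma dual_basis_X:
  assumes "j < s" "k < s"
  shows "dual_basis smul s X j (X k) = (if k = j then 1 else 0)"
  using assms inj_X
  by (auto simp: dual_basis_def representation_basis[OF independent_X] inj_on_def)

lemma structure_constant_abelian:
  assumes "i < t" "j < t"
  shows "structure_constant smul bracket s X i j k = 0"
proof -
  have "X i \<in> L2" "X j \<in> L2"
    using assms span_superset[of "X ` {..<t}"] span_L2 by auto
  then have "bracket (X i) (X j) = 0"
    using abelian_L2 by (simp add: abelian_subalgebra_def)
  then show ?thesis by (simp add: structure_constant_def representation_zero)
qed

lemma dim_L2: "dim L2 = t"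
proof -
  have "independent (X ` {..<t})"
    by (rule independent_mono[OF independent_X]) (use t_le_s in auto)
  then have "dim L2 = card (X ` {..<t})"
    using dim_span_eq_card_independent span_L2 by metis
  then show ?thesis
    using inj_on_subset[OF inj_X, of "{..<t}"] t_le_s by (simp add: card_image)
qed

lemma dim_L1: "dim L1 = s - t"
proof -
  have "independent (X ` {t..<s})"
    by (rule independent_mono[OF independent_X]) auto
  then have "dim L1 = card (X ` {t..<s})"
    using dim_span_eq_card_independent span_L1 by metis
  moreover have "inj_on X {t..<s}" by (rule inj_on_subset[OF inj_X]) auto
  ultimately show ?thesis by (simp add: card_image)
qed

lemma bracket_matrix_scaled_left_inverse:
  assumes "dim L2 \<ge> dim L1"
    and "has_maximal_rank (structure_constant smul bracket s X) t s"
  obtains q D where "q \<noteq> 0"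
    "\<And>l j. l < s - t \<Longrightarrow> j < s - t \<Longrightarrow>
       (\<Sum>i<t. D l i * bracket_poly (structure_constant smul bracket s X) s i (t + j)) =
       (if l = j then q else 0)"
proof -
  have "vec_space.rank t (mat t (s - t)
      (\<lambda>(i, j). to_fract (bracket_poly (structure_constant smul bracket s X) s i (t + j)))) = s - t"
    using assms unfolding has_maximal_rank_def bracket_matrix_def dim_L1 dim_L2 by simp
  then show ?thesis by (rule full_column_rank_imp_scaled_left_inverse) (rule that)
qed

end

section \<open>Reduction of the system of equations\<close>

text \<open>When the derivatives with index at least \<open>t\<close> vanish, the sums over \<open>j < s\<close> collapse to sums over \<open>j < t\<close>.
  For \<open>i < t\<close> the coefficients in these are brackets inside the abelian subalgebra.\<close>
lemma formal_invariant_iff_reduced: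
  assumes "t \<le> s"
    and abelian: "\<And>i j k. i < t \<Longrightarrow> j < t \<Longrightarrow> c i j k = 0"
    and F: "formal_depends_only t s F"
  shows "formal_invariant c s a F \<longleftrightarrow> formal_reduced_system c t s a F"
proof -
  have ps_0: "ps_mult P Q \<gamma> = 0" if "P = (\<lambda>_. 0) \<or> Q = (\<lambda>_. 0)" for P Q :: "'a power_series" and \<gamma>
    using that by (auto simp: ps_mult_def split_def)
  have tail: "ps_mult P (ps_partial (t + j) F) \<gamma> = 0" if "j < s - t" for P j \<gamma>
    using F that by (intro ps_0 disjI2) (auto simp: formal_depends_only_def)
  have zero: "ps_mult (ps_bracket c s a i j) Q \<gamma> = 0" if "i < t" "j < t" for i j Q \<gamma>
    using abelian[OF that] by (intro ps_0 disjI1) (simp add: ps_bracket_def)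
  have *: "(\<Sum>j<s. ps_mult (ps_bracket c s a i j) (ps_partial j F) \<gamma>) =
      (\<Sum>j<t. ps_mult (ps_bracket c s a i j) (ps_partial j F) \<gamma>)" for i \<gamma>
    by (simp add: sum_lessThan_split[OF \<open>t \<le> s\<close>] tail)
  show ?thesis
  proof
    assume "formal_invariant c s a F"
    then show "formal_reduced_system c t s a F"
      by (auto simp: formal_invariant_def formal_reduced_system_def simp flip: *)
  next
    assume red: "formal_reduced_system c t s a F"
    show "formal_invariant c s a F"
      unfolding formal_invariant_def *
    proof (intro allI impI)
      fix i \<gamma> assume "i < s"
      then show "(\<Sum>j<t. ps_mult (ps_bracket c s a i j) (ps_partial j F) \<gamma>) = 0"
        using red zero by (cases "i < t") (auto simp: formal_reduced_system_def)
    qed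
  qed
qed

lemma analytic_invariant_iff_reduced:
  assumes "t \<le> s"
    and abelian: "\<And>i j k. i < t \<Longrightarrow> j < t \<Longrightarrow> structure_constant smul bracket s X i j k = 0"
    and F: "analytic_depends_only smul t s X U F"
  shows "analytic_invariant smul bracket s X U F \<longleftrightarrow>
         analytic_reduced_system smul bracket t s X U F"
proof -
  have zero: "bracket_function smul bracket s X i j f = 0" if "i < t" "j < t" for i j f
    using abelian[OF that] by (simp add: bracket_function_def)
  have *: "(\<Sum>j<s. bracket_function smul bracket s X i j f * coord_partial smul s X j F f) =
      (\<Sum>j<t. bracket_function smul bracket s X i j f * coord_partial smul s X j F f)"
    if "f \<in> U" for i f
    using F that by (simp add: sum_lessThan_split[OF \<open>t \<le> s\<close>] analytic_depends_only_def)
  show ?thesis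
  proof
    assume "analytic_invariant smul bracket s X U F"
    then show "analytic_reduced_system smul bracket t s X U F"
      by (auto simp: analytic_invariant_def analytic_reduced_system_def simp flip: *)
  next
    assume red: "analytic_reduced_system smul bracket t s X U F"
    show "analytic_invariant smul bracket s X U F"
      unfolding analytic_invariant_def
    proof (intro allI impI ballI)
      fix i f assume "i < s" "f \<in> U"
      then show "(\<Sum>j<s. bracket_function smul bracket s X i j f * coord_partial smul s X j F f) = 0"
        using red zero by (cases "i < t") (auto simp: * analytic_reduced_system_def)
    qed
  qed
qed

section \<open>Analytic invariants\<close>

text \<open>The polynomial \<open>q\<close> may involve variables with index at least \<open>s\<close>, which have no meaning on the dual
  space, so \<open>z\<close> is free there: the entries of \<open>B\<close> only see the coordinates below \<open>s\<close>.\<close>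
lemma analytic_partial_eq_0_at_generic_point:
  fixes smul :: "'k::real_normed_field \<Rightarrow> 'v::ab_group_add \<Rightarrow> 'v"
    and bracket :: "'v \<Rightarrow> 'v \<Rightarrow> 'v" and X :: "nat \<Rightarrow> 'v" and s :: nat
  defines "c \<equiv> structure_constant smul bracket s X"
  assumes dec: "abelian_decomposition smul bracket L1 L2 t s X"
    and inverse: "\<And>l j. l < s - t \<Longrightarrow> j < s - t \<Longrightarrow>
        (\<Sum>i<t. D l i * bracket_poly c s i (t + j)) = (if l = j then q else 0)"
    and inv: "analytic_invariant smul bracket s X U F" and "f \<in> U"
    and z: "\<And>k. k < s \<Longrightarrow> z k = f (X k)" and generic: "mpoly_eval (\<lambda>c. c) z q \<noteq> 0"
    and j: "j \<in> {t..<s}"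
  shows "coord_partial smul s X j F f = 0"
proof -
  interpret abelian_decomposition smul bracket L1 L2 t s X by (rule dec)
  note hom = comm_semiring_hom.mpoly_eval_sum[OF comm_semiring_hom_ident]
    comm_semiring_hom.mpoly_eval_mult[OF comm_semiring_hom_ident]
    comm_semiring_hom.mpoly_eval_0[OF comm_semiring_hom_ident]
  define l where "l = j - t"
  have l: "l < s - t" "j = t + l" using j by (auto simp: l_def)
  have bracket: "bracket_function smul bracket s X i j f = mpoly_eval (\<lambda>c. c) z (bracket_poly c s i j)" for i j
    by (simp add: bracket_function_def c_def mpoly_eval_bracket_poly[OF comm_semiring_hom_ident] z)
  have "mpoly_eval (\<lambda>c. c) z q * coord_partial smul s X (t + l) F f = 0"
  proof (rule scaled_left_inverse_cancel[OF _ _ l(1)])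
    fix j assume "j < s - t"
    have "(\<Sum>i<t. mpoly_eval (\<lambda>c. c) z (D l i) * mpoly_eval (\<lambda>c. c) z (bracket_poly c s i (t + j))) =
        mpoly_eval (\<lambda>c. c) z (\<Sum>i<t. D l i * bracket_poly c s i (t + j))"
      by (simp add: hom)
    then show "(\<Sum>i<t. mpoly_eval (\<lambda>c. c) z (D l i) * mpoly_eval (\<lambda>c. c) z (bracket_poly c s i (t + j))) =
        (if l = j then mpoly_eval (\<lambda>c. c) z q else 0)"
      using inverse[OF l(1) \<open>j < s - t\<close>] by (simp add: hom)
  next
    fix i assume "i < t"
    have zero: "bracket_function smul bracket s X i j f = 0" if "j < t" for j
      using structure_constant_abelian[OF \<open>i < t\<close> that] by (simp add: bracket_function_def)
    have "(\<Sum>j<s. bracket_function smul bracket s X i j f * coord_partial smul s X j F f) = 0"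
      using inv \<open>f \<in> U\<close> \<open>i < t\<close> t_le_s by (simp add: analytic_invariant_def)
    then show "(\<Sum>j<s - t. mpoly_eval (\<lambda>c. c) z (bracket_poly c s i (t + j)) *
        coord_partial smul s X (t + j) F f) = 0"
      using zero by (simp add: sum_lessThan_split[OF t_le_s] bracket)
  qed
  then show ?thesis using generic l(2) by simp
qed

text \<open>The partial derivative is known to vanish only at generic points. Instead of its continuity, the
  proof uses the continuity of \<open>F\<close> along lines: \<open>F\<close> is constant in the direction of \<open>x\<^sub>j\<close> near generic points
  \<open>p + h \<omega>\<close>, on segments of a length independent of \<open>h\<close>, and this persists in the limit \<open>h = 0\<close>.\<close>
lemma analytic_invariant_depends_only:
  fixes smul :: "'k::{real_normed_field, euclidean_space} \<Rightarrow> 'v::ab_group_add \<Rightarrow> 'v"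
    and bracket :: "'v \<Rightarrow> 'v \<Rightarrow> 'v" and X :: "nat \<Rightarrow> 'v" and s :: nat
  defines "c \<equiv> structure_constant smul bracket s X"
  assumes dec: "abelian_decomposition smul bracket L1 L2 t s X"
    and "q \<noteq> 0"
    and inverse: "\<And>l j. l < s - t \<Longrightarrow> j < s - t \<Longrightarrow>
        (\<Sum>i<t. D l i * bracket_poly c s i (t + j)) = (if l = j then q else 0)"
    and U: "dual_domain smul U" and F: "analytic_in_coords s X U F"
    and inv: "analytic_invariant smul bracket s X U F"
  shows "analytic_depends_only smul t s X U F"
  unfolding analytic_depends_only_def
proof (intro ballI)
  fix j p assume j: "j \<in> {t..<s}" and "p \<in> U"
  interpret abelian_decomposition smul bracket L1 L2 t s X by (rule dec)
  have generic_0: "coord_partial smul s X j F f = 0"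
    if "f \<in> U" "\<And>k. k < s \<Longrightarrow> z k = f (X k)" "mpoly_eval (\<lambda>c. c) z q \<noteq> 0" for f z
    by (rule analytic_partial_eq_0_at_generic_point[OF dec inverse[unfolded c_def] inv that j])
  obtain y where y: "mpoly_eval (\<lambda>c. c) y q \<noteq> 0" using \<open>q \<noteq> 0\<close> by (rule mpoly_nonzero_imp_nonroot)
  \<comment> \<open>The line from \<open>p\<close> to \<open>y\<close>; beyond index \<open>s\<close> it stays constantly at \<open>y\<close>.\<close>
  define a where "a k = (if k < s then p (X k) else y k)" for k
  define w where "w k = y k - a k" for k
  define \<omega> where "\<omega> = (\<lambda>v. \<Sum>k<s. w k * dual_basis smul s X k v)"
  define e where "e = dual_basis smul s X j"
  define \<phi> where "\<phi> = (\<lambda>h \<epsilon>. F (\<lambda>v. p v + h * \<omega> v + \<epsilon> * e v))"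
  have p_dual: "p \<in> dual_space smul"
    using U \<open>p \<in> U\<close> openin_subset by (fastforce simp: dual_domain_def)
  have e_dual: "e \<in> dual_space smul" by (simp add: e_def dual_basis_in_dual_space)
  have \<omega>_dual: "\<omega> \<in> dual_space smul"
    unfolding \<omega>_def by (rule dual_space_sum[OF _ p_dual]) (auto simp: dual_basis_in_dual_space)
  have \<omega>_X: "\<omega> (X k) = w k" if "k < s" for k
    using that by (simp add: \<omega>_def dual_basis_X if_distrib[of "\<lambda>x. _ * x"] cong: if_cong)
  obtain \<rho> where \<rho>: "\<rho> > 0" and in_U: "\<And>h \<epsilon>. norm h < \<rho> \<Longrightarrow> norm \<epsilon> < \<rho> \<Longrightarrow>
      (\<lambda>v. p v + h * \<omega> v + \<epsilon> * e v) \<in> U"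
    using dual_domain_contains_plane_disc[OF U \<open>p \<in> U\<close> \<omega>_dual e_dual] by blast
  define Q where "Q = mpoly_eval (\<lambda>c. [:c:]) (\<lambda>k. [:a k, w k:]) q"
  have "poly Q 1 \<noteq> 0" using y by (simp add: Q_def poly_mpoly_eval w_def)
  then have "Q \<noteq> 0" by auto
  have const: "\<phi> h \<epsilon> = \<phi> h 0" if h: "norm h < \<rho>" "poly Q h \<noteq> 0" and "norm \<epsilon> < \<rho>" for h \<epsilon>
  proof -
    \<comment> \<open>\<open>R\<close> is \<open>q\<close> on the segment through \<open>p + h \<omega>\<close> in direction \<open>e\<close>; its roots are the only points where
      the derivative is not yet known to vanish.\<close>
    define R where "R = mpoly_eval (\<lambda>c. [:c:]) (\<lambda>k. [:a k + h * w k, if k = j then 1 else 0:]) q"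
    have "poly R 0 = poly Q h" by (simp add: R_def Q_def poly_mpoly_eval)
    then have "R \<noteq> 0" using h(2) by auto
    have deriv: "(\<phi> h has_field_derivative coord_partial smul s X j F (\<lambda>v. p v + h * \<omega> v + \<epsilon> * e v)) (at \<epsilon>)"
      if "norm \<epsilon> < \<rho>" for \<epsilon>
      using analytic_has_derivative_along_line[OF U F in_U[OF h(1) that] e_dual]
      by (simp add: \<phi>_def coord_partial_def e_def)
    have deriv_0: "(\<phi> h has_field_derivative 0) (at \<epsilon>)" if "norm \<epsilon> < \<rho>" "poly R \<epsilon> \<noteq> 0" for \<epsilon>
    proof -
      have "coord_partial smul s X j F (\<lambda>v. p v + h * \<omega> v + \<epsilon> * e v) = 0"
        by (rule generic_0[OF in_U[OF h(1) that(1)],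
              of "\<lambda>k. a k + h * w k + \<epsilon> * (if k = j then 1 else 0)"])
          (use that(2) j in \<open>auto simp: \<omega>_X e_def dual_basis_X a_def R_def poly_mpoly_eval\<close>)
      then show ?thesis using deriv[OF that(1)] by simp
    qed
    have "continuous_on (ball 0 \<rho>) (\<phi> h)"
      using deriv by (intro continuous_at_imp_continuous_on ballI) (auto intro: DERIV_isCont)
    then have "\<phi> h constant_on ball 0 \<rho>"
      using \<open>R \<noteq> 0\<close> deriv_0
      by (intro DERIV_zero_connected_constant_on[of _ "{\<epsilon>. poly R \<epsilon> = 0}"])
        (auto simp: poly_roots_finite)
    then show ?thesis using that(3) \<rho> by (auto simp: constant_on_def)
  qed
  have cont: "isCont (\<lambda>h. \<phi> h \<epsilon>) 0" if "norm \<epsilon> < \<rho>" for \<epsilon>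
  proof -
    have "(\<lambda>v. p v + \<epsilon> * e v) \<in> U" using in_U[of 0 \<epsilon>] that \<rho> by simp
    from analytic_differentiable_along_line_at_0[OF U F this \<omega>_dual]
    show ?thesis
      by (simp add: \<phi>_def add_ac field_differentiable_imp_continuous_at)
  qed
  have line_const: "\<phi> 0 \<epsilon> = \<phi> 0 0" if "norm \<epsilon> < \<rho>" for \<epsilon>
  proof -
    have "((\<lambda>h. \<phi> h \<epsilon> - \<phi> h 0) \<longlongrightarrow> \<phi> 0 \<epsilon> - \<phi> 0 0) (at 0)"
      using cont[OF that] cont[of 0] \<rho> by (intro tendsto_diff) (auto simp: isCont_def)
    moreover have "eventually (\<lambda>h. \<phi> h \<epsilon> - \<phi> h 0 = 0) (at 0)"
    proof -
      have "eventually (\<lambda>h. h \<notin> {h. poly Q h = 0}) (at 0)"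
        using poly_roots_finite[OF \<open>Q \<noteq> 0\<close>] islimpt_finite islimpt_iff_eventually by blast
      moreover have "eventually (\<lambda>h::'k. norm h < \<rho>) (at 0)"
        using \<rho> by (auto simp: eventually_at intro!: exI[of _ \<rho>])
      ultimately show ?thesis
        by eventually_elim (use const that in auto)
    qed
    then have "((\<lambda>h. \<phi> h \<epsilon> - \<phi> h 0) \<longlongrightarrow> 0) (at 0)"
      by (rule tendsto_eventually)
    ultimately have "\<phi> 0 \<epsilon> - \<phi> 0 0 = 0"
      using tendsto_unique[OF at_neq_bot] by blast
    then show ?thesis by simp
  qed
  have "((\<lambda>\<epsilon>. \<phi> 0 \<epsilon>) has_field_derivative 0) (at 0)"
  proof (rule has_field_derivative_transform_within_open)
    show "((\<lambda>_. \<phi> 0 0) has_field_derivative 0) (at 0)" by (rule DERIV_const)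
    show "\<phi> 0 0 = \<phi> 0 \<epsilon>" if "\<epsilon> \<in> ball 0 \<rho>" for \<epsilon>
      using line_const[of \<epsilon>] that by (metis mem_ball_0)
  qed (use \<rho> in auto)
  then show "coord_partial smul s X j F p = 0"
    by (simp add: \<phi>_def coord_partial_def e_def DERIV_imp_deriv)
qed

section \<open>Invariants of an abelian decomposition\<close>

lemma analytic_invariants:
  fixes smul :: "'k::{real_normed_field, euclidean_space} \<Rightarrow> 'v::ab_group_add \<Rightarrow> 'v"
  assumes "abelian_decomposition smul bracket L1 L2 t s X"
    and "vector_space.dim smul L2 \<ge> vector_space.dim smul L1"
    and "has_maximal_rank (structure_constant smul bracket s X) t s"
    and "dual_domain smul U" "analytic_in_coords s X U F"
  shows "(analytic_invariant smul bracket s X U F \<longrightarrow> analytic_depends_only smul t s X U F) \<and>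
    (analytic_invariant smul bracket s X U F \<longleftrightarrow>
       analytic_depends_only smul t s X U F \<and> analytic_reduced_system smul bracket t s X U F)"
proof -
  interpret abelian_decomposition smul bracket L1 L2 t s X by (rule assms)
  obtain q D where "q \<noteq> 0" "\<And>l j. l < s - t \<Longrightarrow> j < s - t \<Longrightarrow>
       (\<Sum>i<t. D l i * bracket_poly (structure_constant smul bracket s X) s i (t + j)) =
       (if l = j then q else 0)"
    using bracket_matrix_scaled_left_inverse[OF assms(2,3)] by blast
  then have "analytic_invariant smul bracket s X U F \<Longrightarrow> analytic_depends_only smul t s X U F"
    by (rule analytic_invariant_depends_only[OF assms(1) _ _ assms(4,5)])
  moreover have "analytic_invariant smul bracket s X U F \<longleftrightarrow>
      analytic_reduced_system smul bracket t s X U F" if "analytic_depends_only smul t s X U F"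
    by (rule analytic_invariant_iff_reduced[OF t_le_s _ that]) (rule structure_constant_abelian)
  ultimately show ?thesis by blast
qed

lemma formal_invariants:
  fixes smul :: "'k::field_char_0 \<Rightarrow> 'v::ab_group_add \<Rightarrow> 'v"
    and bracket :: "'v \<Rightarrow> 'v \<Rightarrow> 'v" and X :: "nat \<Rightarrow> 'v" and s :: nat
  defines "c \<equiv> structure_constant smul bracket s X"
  assumes "abelian_decomposition smul bracket L1 L2 t s X"
    and "vector_space.dim smul L2 \<ge> vector_space.dim smul L1"
    and "has_maximal_rank c t s"
    and "power_series_in s F"
  shows "(formal_invariant c s a F \<longrightarrow> formal_depends_only t s F) \<and>
    (formal_invariant c s a F \<longleftrightarrow> formal_depends_only t s F \<and> formal_reduced_system c t s a F)"
proof -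
  interpret abelian_decomposition smul bracket L1 L2 t s X by (rule assms)
  have abelian: "c i j k = 0" if "i < t" "j < t" for i j k
    using structure_constant_abelian[OF that] by (simp add: c_def)
  obtain q D where qD: "q \<noteq> 0" "\<And>l j. l < s - t \<Longrightarrow> j < s - t \<Longrightarrow>
       (\<Sum>i<t. D l i * bracket_poly c s i (t + j)) = (if l = j then q else 0)"
    using bracket_matrix_scaled_left_inverse[OF assms(3) assms(4)[unfolded c_def]]
    unfolding c_def by blast
  have "formal_invariant c s a F \<Longrightarrow> formal_depends_only t s F"
    by (rule formal_invariant_depends_only[OF t_le_s abelian qD assms(5)])
  moreover have "formal_invariant c s a F \<longleftrightarrow> formal_reduced_system c t s a F"
    if "formal_depends_only t s F"
    by (rule formal_invariant_iff_reduced[OF t_le_s _ that]) (rule abelian)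
  ultimately show ?thesis by blast
qed

theorem theorem6:
  shows
    "(\<forall>(smul :: 'k::field_char_0 \<Rightarrow> 'v::ab_group_add \<Rightarrow> 'v) bracket L1 L2 t s X.
        abelian_decomposition smul bracket L1 L2 t s X \<and>
        vector_space.dim smul L2 \<ge> vector_space.dim smul L1 \<and>
        has_maximal_rank (structure_constant smul bracket s X) t s \<longrightarrow>
        (\<forall>p\<in>dual_space smul. \<forall>F. power_series_in s F \<longrightarrow>
          (formal_invariant (structure_constant smul bracket s X) s (\<lambda>k. p (X k)) F \<longrightarrow>
             formal_depends_only t s F) \<and>
          (formal_invariant (structure_constant smul bracket s X) s (\<lambda>k. p (X k)) F \<longleftrightarrow>
             formal_depends_only t s F \<and>
             formal_reduced_system (structure_constant smul bracket s X) t s (\<lambda>k. p (X k)) F)))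
   \<and> (\<forall>(smul :: real \<Rightarrow> 'w::ab_group_add \<Rightarrow> 'w) bracket L1 L2 t s X.
        abelian_decomposition smul bracket L1 L2 t s X \<and>
        vector_space.dim smul L2 \<ge> vector_space.dim smul L1 \<and>
        has_maximal_rank (structure_constant smul bracket s X) t s \<longrightarrow>
        (\<forall>U F. dual_domain smul U \<and> analytic_in_coords s X U F \<longrightarrow>
          (analytic_invariant smul bracket s X U F \<longrightarrow>
             analytic_depends_only smul t s X U F) \<and>
          (analytic_invariant smul bracket s X U F \<longleftrightarrow>
             analytic_depends_only smul t s X U F \<and>
             analytic_reduced_system smul bracket t s X U F)))
   \<and> (\<forall>(smul :: complex \<Rightarrow> 'u::ab_group_add \<Rightarrow> 'u) bracket L1 L2 t s X.
        abelian_decomposition smul bracket L1 L2 t s X \<and>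
        vector_space.dim smul L2 \<ge> vector_space.dim smul L1 \<and>
        has_maximal_rank (structure_constant smul bracket s X) t s \<longrightarrow>
        (\<forall>U F. dual_domain smul U \<and> analytic_in_coords s X U F \<longrightarrow>
          (analytic_invariant smul bracket s X U F \<longrightarrow>
             analytic_depends_only smul t s X U F) \<and>
          (analytic_invariant smul bracket s X U F \<longleftrightarrow>
             analytic_depends_only smul t s X U F \<and>
             analytic_reduced_system smul bracket t s X U F)))"
  by (intro conjI allI impI ballI; elim conjE)
    (use formal_invariants analytic_invariants in blast)+

end
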